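(* For every integer $n\geq1$, \[ h_{n}=\sum_{|\lambda|=n}\big(q^{|\lambda|-l(\lambda)}[z_{\lambda}]_{q^{-1}}\big)^{-1}[p_{\lambda}]_{q}, \] where the sum is over all integer partitions $\lambda$ of $n$ and, for $\lambda=(\lambda_1,\dots,\lambda_r)$ a partition of $n$, \[ \big([z_{\lambda}]_{q^{-1}}\big)^{-1}=\sum_{u}\big([n]_{q^{-1}}[n-u_{1}]_{q^{-1}}[n-u_{1}-u_{2}]_{q^{-1}}\cdots[n-u_1-\cdots-u_{r-1}]_{q^{-1}}\big)^{-1}, \] the sum being over all distinct permutations $u=(u_1,\dots,u_r)$ of $(\lambda_1,\dots,\lambda_r)$.
   Context: Let $q$ be an indeterminate and $K$ a field containing $\mathbb{Q}(q)$. $\Lambda_K$ is the algebra of symmetric functions in indeterminates $x_1,x_2,\dots$ with coefficients in $K$; $e_n$, $h_n$ denote the elementary and complete homogeneous symmetric functions ($e_0=h_0=1$), $E(t)=\sum_{n\geq0}e_nt^n$. For $n\geq1$, $[n]_q=1+q+\cdots+q^{n-1}$, $[0]_q=0$, and $[m]_{q^{-1}}$ is obtained by replacing $q$ by $q^{-1}$. For a formal power series $F(t)$, $D_qF(t)=\dfrac{F(qt)-F(t)}{(q-1)t}$. The $q$-power sums $[p_n]_q\in\Lambda_K$ ($n\geq1$) are defined by $\sum_{n\geq1}[p_n]_q(-t)^{n-1}=D_qE(t)/E(t)$, and for a partition $\lambda=(\lambda_1,\dots,\lambda_r)$, $[p_\lambda]_q=[p_{\lambda_1}]_q\cdots[p_{\lambda_r}]_q$.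 $|\lambda|$ is the sum of the parts and $l(\lambda)$ the number of parts. *)

theory Defs
  imports
    "HOL-Computational_Algebra.Computational_Algebra"
    "HOL-Combinatorics.Multiset_Permutations"
begin

section \<open>The algebra of symmetric functions\<close>

text \<open>
  A monomial in the variables \<open>x\<^sub>0, x\<^sub>1, \<dots>\<close> is the finite multiset of the indices occurring in it:
  \<open>{#0, 0, 3#}\<close> stands for \<open>x\<^sub>0\<^sup>2 x\<^sub>3\<close>. The product of monomials is then \<open>+\<close>, the degree is \<^const>\<open>size\<close>,
  and a permutation of the variables acts by \<^const>\<open>image_mset\<close>. A symmetric function is a formal
  (in general infinite) linear combination of monomials that has bounded degree and is invariant
  under all permutations of the variables; it is given by its family of coefficients.
\<close>

typedef (overloaded) 'k symfun =
  "{f :: nat multiset \<Rightarrow> 'k :: zero.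
      (\<forall>\<pi> m. bij \<pi> \<longrightarrow> f (image_mset \<pi> m) = f m) \<and>
      (\<exists>d. \<forall>m. f m \<noteq> 0 \<longrightarrow> size m \<le> d)}"
  morphisms sf_coeff Abs_symfun
  by (rule exI[of _ "\<lambda>_. 0"]) auto

setup_lifting type_definition_symfun

lemma symfun_eqI: "(\<And>m. sf_coeff f m = sf_coeff g m) \<Longrightarrow> f = g"
  by (simp add: sf_coeff_inject[symmetric] fun_eq_iff)

lemma finite_submultisets: "finite {a. a \<subseteq># m}"
proof (induction m)
  case (add x m)
  have "{a. a \<subseteq># add_mset x m} \<subseteq> {a. a \<subseteq># m} \<union> add_mset x ` {a. a \<subseteq># m}"
  proof
    fix a assume "a \<in> {a. a \<subseteq># add_mset x m}"
    hence a: "a \<subseteq># add_mset x m" by simp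
    show "a \<in> {a. a \<subseteq># m} \<union> add_mset x ` {a. a \<subseteq># m}"
    proof (cases "x \<in># a")
      case True
      then obtain b where "a = add_mset x b" by (metis insert_DiffM)
      with a show ?thesis by auto
    next
      case False
      with a show ?thesis
        by (metis Diff_eq_empty_iff_mset UnI1 mem_Collect_eq minus_add_mset_if_not_in_lhs)
    qed
  qed
  with add.IH show ?case by (meson finite_Un finite_imageI finite_subset)
qed simp

definition mono_conv :: "(nat multiset \<Rightarrow> 'k :: comm_ring_1) \<Rightarrow> (nat multiset \<Rightarrow> 'k) \<Rightarrow> nat multiset \<Rightarrow> 'k"
  where "mono_conv f g m = (\<Sum>a | a \<subseteq># m. f a * g (m - a))"

lemma mono_conv_pairs: "mono_conv f g m = (\<Sum>(a, b) | a + b = m. f a * g b)"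
  unfolding mono_conv_def
  by (rule sum.reindex_bij_witness[of _ fst "\<lambda>a. (a, m - a)"]) auto

lemma finite_mono_pairs: "finite {(a, b). a + b = (m :: nat multiset)}"
proof (rule finite_subset)
  show "{(a, b). a + b = m} \<subseteq> {a. a \<subseteq># m} \<times> {a. a \<subseteq># m}" by auto
qed (simp add: finite_submultisets)

lemma mono_conv_commute: "mono_conv f g = mono_conv g f"
  unfolding mono_conv_pairs fun_eq_iff
  by (intro allI sum.reindex_bij_witness[of _ prod.swap prod.swap]) (auto simp: add.commute mult.commute)

lemma mono_conv_assoc: "mono_conv (mono_conv f g) h = mono_conv f (mono_conv g h)"
proof
  fix m
  have "mono_conv (mono_conv f g) h m =
      (\<Sum>p | fst p + snd p = m. \<Sum>r | fst r + snd r = fst p. f (fst r) * g (snd r) * h (snd p))"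
    by (simp add: mono_conv_pairs case_prod_beta' sum_distrib_right)
  also have "\<dots> = (\<Sum>(p, r) \<in> Sigma {p. fst p + snd p = m} (\<lambda>p. {r. fst r + snd r = fst p}).
      f (fst r) * g (snd r) * h (snd p))"
    by (rule sum.Sigma) (use finite_mono_pairs in \<open>auto simp: case_prod_beta'\<close>)
  also have "\<dots> = (\<Sum>(p, r) \<in> Sigma {p. fst p + snd p = m} (\<lambda>p. {r. fst r + snd r = snd p}).
      f (fst p) * (g (fst r) * h (snd r)))"
    by (rule sum.reindex_bij_witness[of _
          "\<lambda>(p, r). ((fst p + fst r, snd r), (fst p, fst r))"
          "\<lambda>(p, r). ((fst r, snd r + snd p), (snd r, snd p))"])
       (auto simp: add.assoc mult.assoc)
  also have "\<dots> = (\<Sum>p | fst p + snd p = m. \<Sum>r | fst r + snd r = snd p. f (fst p) * (g (fst r) * h (snd r)))"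
    by (rule sum.Sigma[symmetric]) (use finite_mono_pairs in \<open>auto simp: case_prod_beta'\<close>)
  also have "\<dots> = mono_conv f (mono_conv g h) m"
    by (simp add: mono_conv_pairs case_prod_beta' sum_distrib_left)
  finally show "mono_conv (mono_conv f g) h m = mono_conv f (mono_conv g h) m" .
qed

lemma mono_conv_symmetric:
  assumes \<pi>: "bij \<pi>"
    and f: "\<And>m. f (image_mset \<pi> m) = f m" and g: "\<And>m. g (image_mset \<pi> m) = g m"
  shows "mono_conv f g (image_mset \<pi> m) = mono_conv f g m"
proof -
  have 1: "image_mset \<pi> (image_mset (inv \<pi>) a) = a" for a
    using \<pi> by (simp add: multiset.map_comp o_def bij_is_surj surj_f_inv_f)
  have 2: "image_mset (inv \<pi>) (image_mset \<pi> a) = a" for a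
    using \<pi> by (simp add: multiset.map_comp o_def bij_is_inj inv_f_f)
  have "mono_conv f g m = mono_conv f g (image_mset \<pi> m)"
    unfolding mono_conv_pairs
    by (rule sum.reindex_bij_witness[of _
          "\<lambda>(a, b). (image_mset (inv \<pi>) a, image_mset (inv \<pi>) b)"
          "\<lambda>(a, b). (image_mset \<pi> a, image_mset \<pi> b)"])
       (auto simp: 1 2 f g simp flip: image_mset_union)
  thus ?thesis ..
qed

lemma mono_conv_bounded:
  assumes f: "\<And>m. f m \<noteq> 0 \<Longrightarrow> size m \<le> d" and g: "\<And>m. g m \<noteq> 0 \<Longrightarrow> size m \<le> d'"
    and nz: "mono_conv f g m \<noteq> 0"
  shows "size m \<le> d + d'"
proof -
  from nz obtain a b where "a + b = m" "f a * g b \<noteq> 0"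
    unfolding mono_conv_pairs by (auto elim!: sum.not_neutral_contains_not_neutral)
  hence "f a \<noteq> 0" "g b \<noteq> 0" "size m = size a + size b" by auto
  thus ?thesis using f[of a] g[of b] by simp
qed

text \<open>The embedding of the coefficient ring as constants; multiplying by such a constant is
  scalar multiplication.\<close>

lift_definition sf_const :: "'k :: zero \<Rightarrow> 'k symfun"
  is "\<lambda>c m. if m = {#} then c else 0"
  by (auto intro!: exI[of _ 0])

instantiation symfun :: (comm_ring_1) comm_ring_1
begin

lift_definition zero_symfun :: "'a symfun" is "\<lambda>_. 0"
  by auto

lift_definition one_symfun :: "'a symfun" is "\<lambda>m. if m = {#} then 1 else 0"
  by (auto intro!: exI[of _ 0])

lift_definition plus_symfun :: "'a symfun \<Rightarrow> 'a symfun \<Rightarrow> 'a symfun" is "\<lambda>f g m. f m + g m"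
proof -
  fix f g :: "nat multiset \<Rightarrow> 'a"
  assume f: "(\<forall>\<pi> m. bij \<pi> \<longrightarrow> f (image_mset \<pi> m) = f m) \<and> (\<exists>d. \<forall>m. f m \<noteq> 0 \<longrightarrow> size m \<le> d)"
    and g: "(\<forall>\<pi> m. bij \<pi> \<longrightarrow> g (image_mset \<pi> m) = g m) \<and> (\<exists>d. \<forall>m. g m \<noteq> 0 \<longrightarrow> size m \<le> d)"
  from f g obtain d d' where "\<And>m. f m \<noteq> 0 \<Longrightarrow> size m \<le> d" "\<And>m. g m \<noteq> 0 \<Longrightarrow> size m \<le> d'"
    by metis
  hence "\<forall>m. f m + g m \<noteq> 0 \<longrightarrow> size m \<le> max d d'"
    by (metis add_0 max.coboundedI1 max.coboundedI2)
  with f g show "(\<forall>\<pi> m. bij \<pi> \<longrightarrow> f (image_mset \<pi> m) + g (image_mset \<pi> m) = f m + g m) \<and>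
      (\<exists>d. \<forall>m. f m + g m \<noteq> 0 \<longrightarrow> size m \<le> d)"
    by auto
qed

lift_definition uminus_symfun :: "'a symfun \<Rightarrow> 'a symfun" is "\<lambda>f m. - f m"
  by auto

definition minus_symfun :: "'a symfun \<Rightarrow> 'a symfun \<Rightarrow> 'a symfun"
  where "minus_symfun f g = f + - g"

lift_definition times_symfun :: "'a symfun \<Rightarrow> 'a symfun \<Rightarrow> 'a symfun" is mono_conv
proof -
  fix f g :: "nat multiset \<Rightarrow> 'a"
  assume f: "(\<forall>\<pi> m. bij \<pi> \<longrightarrow> f (image_mset \<pi> m) = f m) \<and> (\<exists>d. \<forall>m. f m \<noteq> 0 \<longrightarrow> size m \<le> d)"
    and g: "(\<forall>\<pi> m. bij \<pi> \<longrightarrow> g (image_mset \<pi> m) = g m) \<and> (\<exists>d. \<forall>m. g m \<noteq> 0 \<longrightarrow> size m \<le> d)"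
  from f g obtain d d' where "\<And>m. f m \<noteq> 0 \<Longrightarrow> size m \<le> d" "\<And>m. g m \<noteq> 0 \<Longrightarrow> size m \<le> d'"
    by metis
  from mono_conv_bounded[of f d g d', OF this]
  have "\<exists>d. \<forall>m. mono_conv f g m \<noteq> 0 \<longrightarrow> size m \<le> d" by blast
  with f g show "(\<forall>\<pi> m. bij \<pi> \<longrightarrow> mono_conv f g (image_mset \<pi> m) = mono_conv f g m) \<and>
      (\<exists>d. \<forall>m. mono_conv f g m \<noteq> 0 \<longrightarrow> size m \<le> d)"
    using mono_conv_symmetric[of _ f g] by blast
qed

instance
proof
  fix f g h :: "'a symfun"
  show "f * g * h = f * (g * h)" by transfer (rule mono_conv_assoc)
  show "f * g = g * f" by transfer (rule mono_conv_commute)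
  show "1 * f = f"
  proof transfer
    fix f :: "nat multiset \<Rightarrow> 'a"
    have "mono_conv (\<lambda>m. if m = {#} then 1 else 0) f m = f m" for m
    proof -
      have "mono_conv (\<lambda>m. if m = {#} then 1 else 0) f m = (\<Sum>a | a \<subseteq># m. if a = {#} then f m else 0)"
        unfolding mono_conv_def by (intro sum.cong) auto
      thus ?thesis by (simp add: sum.delta finite_submultisets)
    qed
    thus "mono_conv (\<lambda>m. if m = {#} then 1 else 0) f = f" by blast
  qed
  show "(f + g) * h = f * h + g * h"
    by transfer (simp add: mono_conv_def fun_eq_iff distrib_right sum.distrib)
  show "f + g + h = f + (g + h)" by transfer (simp add: add.assoc)
  show "f + g = g + f" by transfer (simp add: add.commute)
  show "0 + f = f" by transfer simp
  show "- f + f = 0" by transfer simp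
  show "f - g = f + - g" by (simp add: minus_symfun_def)
  show "(0 :: 'a symfun) \<noteq> 1" by transfer (auto simp: fun_eq_iff)
qed

end

lemma sf_coeff_mult: "sf_coeff (f * g) m = (\<Sum>(a, b) | a + b = m. sf_coeff f a * sf_coeff g b)"
  by (simp add: times_symfun.rep_eq mono_conv_pairs)

lemma sf_coeff_const_mult: "sf_coeff (sf_const c * f) m = c * sf_coeff f m"
proof -
  have "sf_coeff (sf_const c * f) m = (\<Sum>a | a \<subseteq># m. if a = {#} then c * sf_coeff f m else 0)"
    unfolding times_symfun.rep_eq mono_conv_def by (intro sum.cong) (auto simp: sf_const.rep_eq)
  thus ?thesis by (simp add: sum.delta finite_submultisets)
qed


section \<open>Elementary and complete homogeneous symmetric functions\<close>

text \<open>\<open>e\<^sub>n\<close> is the sum of all square-free monomials of degree \<open>n\<close>, \<open>h\<^sub>n\<close> the sum of all monomials of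
  degree \<open>n\<close>.\<close>

lift_definition sf_e :: "nat \<Rightarrow> 'k :: zero_neq_one symfun"
  is "\<lambda>n m. if size m = n \<and> (\<forall>i. count m i \<le> 1) then 1 else 0"
proof (intro conjI allI impI)
  fix n :: nat and \<pi> :: "nat \<Rightarrow> nat" and m :: "nat multiset"
  assume \<pi>: "bij \<pi>"
  have c: "count (image_mset \<pi> m) (\<pi> i) = count m i" for i
    using bij_is_inj[OF \<pi>] by (induction m) (auto simp: inj_eq)
  have "(\<forall>i. count (image_mset \<pi> m) i \<le> 1) \<longleftrightarrow> (\<forall>i. count (image_mset \<pi> m) (\<pi> i) \<le> 1)"
    using \<pi> by (metis bij_pointE)
  also have "\<dots> \<longleftrightarrow> (\<forall>i. count m i \<le> 1)"
    by (simp only: c)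
  finally show "(if size (image_mset \<pi> m) = n \<and> (\<forall>i. count (image_mset \<pi> m) i \<le> 1) then 1 else 0) =
      (if size m = n \<and> (\<forall>i. count m i \<le> 1) then 1 else (0 :: 'k))"
    by simp
qed (auto intro!: exI)

lift_definition sf_h :: "nat \<Rightarrow> 'k :: zero_neq_one symfun"
  is "\<lambda>n m. if size m = n then 1 else 0"
  by (auto intro!: exI)

lemma sf_e_0 [simp]: "sf_e 0 = (1 :: 'k :: comm_ring_1 symfun)"
  by transfer auto

lemma sf_h_0 [simp]: "sf_h 0 = (1 :: 'k :: comm_ring_1 symfun)"
  by transfer auto

definition sf_E :: "'k :: comm_ring_1 symfun fps"
  where "sf_E = Abs_fps sf_e"


section \<open>The q-power sums\<close>

text \<open>
  \<open>D\<^sub>q F(t) = (F(qt) - F(t)) / ((q - 1) t)\<close>. The series \<open>F(qt) - F(t)\<close> has constant term \<open>0\<close>, so that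
  \<^term>\<open>fps_shift 1\<close> is the division by \<open>t\<close>.
\<close>

definition q_deriv :: "'k :: field \<Rightarrow> 'k symfun fps \<Rightarrow> 'k symfun fps"
  where "q_deriv q F =
    fps_const (sf_const (inverse (q - 1))) *
      fps_shift 1 (fps_compose F (fps_const (sf_const q) * fps_X) - F)"

text \<open>
  Since \<open>E(0) = 1\<close>, the series \<open>E(t)\<close> is invertible, and \<^term>\<open>fps_right_inverse sf_E 1\<close> is its (two-sided)
  inverse. The coefficient of \<open>t\<^bsup>n-1\<^esup>\<close> in \<open>\<Sum>\<^bsub>n\<ge>1\<^esub> [p\<^sub>n]\<^sub>q (-t)\<^bsup>n-1\<^esup> = D\<^sub>q E(t) / E(t)\<close> is
  \<open>(-1)\<^bsup>n-1\<^esup> [p\<^sub>n]\<^sub>q\<close>. The index \<open>n = 0\<close> is meaningless.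
\<close>

definition q_power_sum :: "'k :: field \<Rightarrow> nat \<Rightarrow> 'k symfun"
  where "q_power_sum q n = (- 1) ^ (n - 1) * fps_nth (q_deriv q sf_E * fps_right_inverse sf_E 1) (n - 1)"

lemma sf_E_right_inverse: "sf_E * fps_right_inverse sf_E 1 = 1"
  by (rule fps_right_inverse) (simp add: sf_E_def)

lemma q_power_sum_generating_function:
  "Abs_fps (\<lambda>n. (- 1) ^ n * q_power_sum q (Suc n)) * sf_E = q_deriv q sf_E"
proof -
  have "Abs_fps (\<lambda>n. (- 1) ^ n * q_power_sum q (Suc n)) = q_deriv q sf_E * fps_right_inverse sf_E 1"
    by (rule fps_ext) (simp add: q_power_sum_def mult.assoc[symmetric] power_mult_distrib[symmetric])
  thus ?thesis using sf_E_right_inverse by (metis mult.assoc mult.commute mult.right_neutral)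
qed


section \<open>Integer partitions and the coefficients\<close>

text \<open>A partition is represented by the multiset of its parts, so \<open>|\<mu>|\<close> is \<^const>\<open>sum_mset\<close> and \<open>l(\<mu>)\<close>
  is \<^const>\<open>size\<close>.\<close>

definition int_partitions :: "nat \<Rightarrow> nat multiset set"
  where "int_partitions n = {\<mu>. (\<forall>i \<in># \<mu>. i \<ge> 1) \<and> sum_mset \<mu> = n}"

lemma finite_int_partitions: "finite (int_partitions n)"
proof (rule finite_subset)
  let ?M = "\<Sum>i\<in>{1..n}. replicate_mset n i"
  show "int_partitions n \<subseteq> {a. a \<subseteq># ?M}"
  proof
    fix \<mu> assume "\<mu> \<in> int_partitions n"
    hence pos: "\<forall>i \<in># \<mu>. i \<ge> 1" and n: "sum_mset \<mu> = n" by (auto simp: int_partitions_def)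
    have le: "count \<mu> i * i \<le> n" for i
    proof -
      have "replicate_mset (count \<mu> i) i \<subseteq># \<mu>" by (simp add: count_le_replicate_mset_subset_eq[symmetric])
      then obtain b where "\<mu> = replicate_mset (count \<mu> i) i + b" by (auto simp: subset_mset.le_iff_add)
      hence "sum_mset \<mu> = count \<mu> i * i + sum_mset b" by (metis sum_mset.union sum_mset_replicate_mset of_nat_id)
      thus ?thesis using n by simp
    qed
    have "\<mu> \<subseteq># ?M"
    proof (rule mset_subset_eqI)
      fix i
      show "count \<mu> i \<le> count ?M i"
      proof (cases "i \<in># \<mu>")
        case True
        hence 1: "i \<ge> 1" and 2: "count \<mu> i \<ge> 1" using pos by auto
        have "i \<le> n" "count \<mu> i \<le> n"
          using le[of i] 1 2 by (metis le_trans mult_le_mono nat_mult_1 nat_mult_1_right order_refl)+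
        thus ?thesis using 1 by (simp add: count_sum sum.delta)
      qed (simp add: not_in_iff)
    qed
    thus "\<mu> \<in> {a. a \<subseteq># ?M}" by simp
  qed
qed (rule finite_submultisets)

definition q_nat :: "'k :: field \<Rightarrow> nat \<Rightarrow> 'k"
  where "q_nat q n = (\<Sum>i<n. q ^ i)"

definition q_power_sum_part :: "'k :: field \<Rightarrow> nat multiset \<Rightarrow> 'k symfun"
  where "q_power_sum_part q \<mu> = (\<Prod>i\<in>#\<mu>. q_power_sum q i)"

text \<open>\<open>[z\<^sub>\<mu>]\<^sub>q\<close> is given through its reciprocal, a sum over all distinct rearrangements \<open>u\<close> of the parts
  of \<open>\<mu>\<close>. The truncated subtraction is harmless: partial sums of \<open>u\<close> do not exceed \<open>|\<mu>|\<close>.\<close>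

definition q_z :: "'k :: field \<Rightarrow> nat multiset \<Rightarrow> 'k"
  where "q_z q \<mu> = inverse (\<Sum>u\<in>permutations_of_multiset \<mu>.
    inverse (\<Prod>i<length u. q_nat q (sum_mset \<mu> - sum_list (take i u))))"

end

theory Submission
  imports Defs
begin

text \<open>
  Since \<open>E(t) H(-t) = 1\<close>, multiplying \<open>E(qt) - E(t) = (q - 1) t D\<^sub>q E(t)\<close> by \<open>H(-t) H(-qt)\<close> and
  comparing coefficients gives \<open>[n] h\<^sub>n = \<Sum>\<^bsub>k=1..n\<^esub> q\<^bsup>1-k\<^esup> [p\<^sub>k]\<^sub>q h\<^bsub>n-k\<^esub>\<close>, with \<open>[n]\<close> taken at \<open>q\<^bsup>-1\<^esup>\<close>.
  Iterating this recurrence expresses \<open>h\<^sub>n\<close> as a sum over the compositions of \<open>n\<close>; the compositions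
  with the same multiset of parts are then collected.
\<close>

section \<open>Constants and coefficients\<close>

lemma sf_coeff_0: "sf_coeff 0 m = 0"
  by transfer simp

lemma sf_coeff_1: "sf_coeff 1 m = (if m = {#} then 1 else 0)"
  by transfer simp

lemma sf_coeff_add: "sf_coeff (f + g) m = sf_coeff f m + sf_coeff g m"
  by transfer simp

lemma sf_coeff_uminus: "sf_coeff (- f) m = - sf_coeff f m"
  by transfer simp

lemma sf_coeff_sum: "sf_coeff (sum f A) m = (\<Sum>x\<in>A. sf_coeff (f x) m)"
  by (induction A rule: infinite_finite_induct) (auto simp: sf_coeff_0 sf_coeff_add)

lemma sf_coeff_minus_one_power_mult: "sf_coeff ((- 1) ^ k * f) m = (- 1) ^ k * sf_coeff f m"
  by (induction k) (auto simp: sf_coeff_uminus mult.assoc)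

lemma sf_const_1: "sf_const 1 = (1 :: 'k :: comm_ring_1 symfun)"
  by transfer auto

lemma sf_const_diff: "sf_const (a - b) = sf_const a - sf_const (b :: 'k :: comm_ring_1)"
  unfolding minus_symfun_def by transfer auto

lemma sf_const_mult: "sf_const (a * b) = sf_const a * sf_const (b :: 'k :: comm_ring_1)"
  by (rule symfun_eqI) (simp add: sf_coeff_const_mult sf_const.rep_eq)

lemma sf_const_power: "sf_const (a ^ n) = sf_const (a :: 'k :: comm_ring_1) ^ n"
  by (induction n) (auto simp: sf_const_1 sf_const_mult)

lemma sf_const_sum: "sf_const (sum f A) = (\<Sum>x\<in>A. sf_const (f x :: 'k :: comm_ring_1))"
  by (rule symfun_eqI) (simp add: sf_coeff_sum sf_const.rep_eq)


section \<open>The generating functions of the elementary and complete symmetric functions\<close>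

text \<open>Square-free submultisets of \<open>m\<close> correspond to subsets of its support, and
  summing (-1)^card over all subsets expands a product of factors 1 - 1, nonempty because
  \<open>m\<close> is.\<close>

lemma sum_alternating_squarefree_submultisets:
  assumes "m \<noteq> {#}"
  shows "(\<Sum>a | a \<subseteq># m \<and> (\<forall>i. count a i \<le> 1). (- 1) ^ size a) = (0 :: 'k :: comm_ring_1)"
proof -
  have sub: "mset_set X \<subseteq># m" if "X \<subseteq> set_mset m" for X
    using that by (meson finite_set_mset finite_subset mset_set_set_mset_msubset msubset_mset_set_iff
        subset_mset.order_trans)
  have ms: "mset_set (set_mset a) = a" if "\<forall>i. count a i \<le> 1" for a :: "'a multiset"
  proof (rule multiset_eqI)
    fix i
    show "count (mset_set (set_mset a)) i = count a i"
      using that[rule_format, of i] by (cases "i \<in># a") (auto simp: not_in_iff count_mset_set'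
          simp flip: count_greater_zero_iff)
  qed
  have card: "card (set_mset a) = size a" if "\<forall>i. count a i \<le> 1" for a :: "'a multiset"
    using ms[OF that] by (metis size_mset_set)
  have "(\<Sum>a | a \<subseteq># m \<and> (\<forall>i. count a i \<le> 1). (- 1) ^ size a) =
      (\<Sum>X\<in>Pow (set_mset m). (- 1) ^ card X :: 'k)"
    by (rule sum.reindex_bij_witness[of _ mset_set set_mset])
       (auto simp: ms card sub count_mset_set' finite_subset dest: mset_subset_eqD)
  also have "\<dots> = (\<Prod>x\<in>set_mset m. 1 - 1)"
    by (subst prod_diff_conv_sum) auto
  also have "\<dots> = 0"
    using assms by (intro prod_zero) auto
  finally show ?thesis .
qed

definition sf_H_neg :: "'k :: comm_ring_1 symfun fps"
  where "sf_H_neg = Abs_fps (\<lambda>n. (- 1) ^ n * sf_h n)"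

text \<open>By homogeneity, a factor \<open>a\<close> of the monomial \<open>m\<close> contributes
  only for \<open>k = size a\<close>, and only if \<open>size m = n\<close>. This leaves the
  alternating sum over square-free divisors of \<open>m\<close>, which vanishes unless
  \<open>m\<close> is empty.\<close>

lemma sf_E_mult_H_neg: "sf_E * sf_H_neg = (1 :: 'k :: comm_ring_1 symfun fps)"
proof (rule fps_ext, rule symfun_eqI)
  fix n m
  have "sf_coeff (fps_nth (sf_E * sf_H_neg) n) m =
      (\<Sum>k=0..n. (- 1) ^ (n - k) * (\<Sum>a | a \<subseteq># m. sf_coeff (sf_e k) a * sf_coeff (sf_h (n - k)) (m - a)) :: 'k)"
    unfolding fps_mult_nth sf_coeff_sum sf_E_def sf_H_neg_def fps_nth_Abs_fps
    by (simp only: mult.left_commute[of "sf_e _" "(- 1) ^ _"] sf_coeff_minus_one_power_mult)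
       (simp only: times_symfun.rep_eq mono_conv_def)
  also have "\<dots> = (\<Sum>a | a \<subseteq># m. \<Sum>k=0..n.
      (- 1) ^ (n - k) * (sf_coeff (sf_e k) a * sf_coeff (sf_h (n - k)) (m - a)))"
    by (simp only: sum_distrib_left) (rule sum.swap)
  also have "\<dots> = (\<Sum>a | a \<subseteq># m. if \<forall>i. count a i \<le> 1 then
      (if size m = n then (- 1) ^ n * (- 1) ^ size a else 0) else 0)"
  proof (rule sum.cong)
    fix a assume "a \<in> {a. a \<subseteq># m}"
    hence a: "size a \<le> size m" "size (m - a) = size m - size a"
      by (auto simp: size_mset_mono size_Diff_submset)
    have "(\<Sum>k=0..n. (- 1) ^ (n - k) * (sf_coeff (sf_e k) a * sf_coeff (sf_h (n - k)) (m - a))) =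
       (\<Sum>k=0..n. if k = size a then (if \<forall>i. count a i \<le> 1 then
         (if size m = n then (- 1) ^ (n - k) else 0) else 0) else (0 :: 'k))"
      using a by (intro sum.cong) (auto simp: sf_e.rep_eq sf_h.rep_eq)
    \<comment> \<open>In the nonzero case \<open>size a \<le> size m = n\<close>, so the truncated
      exponent \<open>n - size a\<close> is exact and has the parity of
      \<open>n + size a\<close>.\<close>
    also have "\<dots> = (if \<forall>i. count a i \<le> 1 then
      (if size m = n then (- 1) ^ n * (- 1) ^ size a else 0) else 0)"
      using a by (auto simp: sum.delta minus_one_power_iff)
    finally show "(\<Sum>k=0..n. (- 1) ^ (n - k) * (sf_coeff (sf_e k) a * sf_coeff (sf_h (n - k)) (m - a))) =
      (if \<forall>i. count a i \<le> 1 then (if size m = n then (- 1) ^ n * (- 1) ^ size a else 0) else (0 :: 'k))" .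
  qed simp
  also have "\<dots> = (if size m = n then
      (- 1) ^ n * (\<Sum>a | a \<subseteq># m \<and> (\<forall>i. count a i \<le> 1). (- 1) ^ size a) else 0)"
    by (auto simp: sum_distrib_left finite_submultisets sum.inter_filter[symmetric] intro!: sum.neutral)
  also have "\<dots> = sf_coeff (fps_nth 1 n) m"
  proof (cases "m = {#}")
    case True
    have "{a. a = {#} \<and> (\<forall>i. count a i \<le> 1)} = {{#} :: nat multiset}" by auto
    with True show ?thesis by (auto simp: sf_coeff_1 sf_coeff_0)
  next
    case False
    thus ?thesis
      using sum_alternating_squarefree_submultisets[OF False, where 'k='k]
      by (simp add: sf_coeff_1 sf_coeff_0)
  qed
  finally show "sf_coeff (fps_nth (sf_E * sf_H_neg) n) m = sf_coeff (fps_nth (1 :: 'k symfun fps) n) m" .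
qed


section \<open>The recurrence for the complete symmetric functions\<close>

text \<open>The library's \<open>fps_compose_mult_distrib\<close> requires an integral domain.\<close>

lemma fps_compose_linear_mult:
  fixes F G :: "'a :: comm_ring_1 fps"
  shows "fps_compose (F * G) (fps_const c * fps_X) =
    fps_compose F (fps_const c * fps_X) * fps_compose G (fps_const c * fps_X)"
proof (rule fps_ext)
  fix n
  have "c ^ n * (fps_nth F i * fps_nth G (n - i)) =
      c ^ i * fps_nth F i * (c ^ (n - i) * fps_nth G (n - i))"
    if "i \<le> n" for i
  proof -
    have "c ^ n = c ^ i * c ^ (n - i)" using that by (simp flip: power_add)
    thus ?thesis by (simp add: mult_ac)
  qed
  thus "fps_nth (fps_compose (F * G) (fps_const c * fps_X)) n =
    fps_nth (fps_compose F (fps_const c * fps_X) * fps_compose G (fps_const c * fps_X)) n"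
    by (simp add: fps_mult_nth sum_distrib_left)
qed

text \<open>The sum is reversed: q^n times q^(-i) is q^(n-i).\<close>

lemma q_nat_inverse:
  assumes "q \<noteq> 0"
  shows "q ^ n * q_nat (inverse q) (Suc n) = q_nat q (Suc n)"
proof -
  have "q ^ n * q_nat (inverse q) (Suc n) = (\<Sum>i<Suc n. q ^ (n - i))"
    unfolding q_nat_def sum_distrib_left using assms
    by (intro sum.cong) (auto simp: power_diff field_simps)
  also have "\<dots> = q_nat q (Suc n)"
    unfolding q_nat_def using sum.nat_diff_reindex[of "\<lambda>i. q ^ i" "Suc n"] by simp
  finally show ?thesis .
qed

lemma fps_X_mult_shift_1:
  fixes F :: "'a :: comm_ring_1 fps"
  assumes "fps_nth F 0 = 0"
  shows "fps_X * fps_shift 1 F = F"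
  using assms by (intro fps_ext) auto

text \<open>This is the recurrence cleared of denominators, with q-integers at \<open>q\<close>
  rather than at its inverse. It compares the coefficients of t^(n+1) in (q-1) t G(t) H(-qt) = H(-t)
  - H(-qt), where G is the signed generating function of the q-power sums.\<close>

lemma q_nat_sf_h:
  fixes q :: "'k :: field"
  assumes q: "q \<noteq> 1"
  shows "sf_const (q_nat q (Suc n)) * sf_h (Suc n) =
    (\<Sum>i\<le>n. sf_const (q ^ (n - i)) * q_power_sum q (Suc i) * sf_h (n - i))"
proof -
  define G where "G = Abs_fps (\<lambda>n. (- 1) ^ n * q_power_sum q (Suc n))"
  define C where "C = fps_const (sf_const (q - 1))"
  define S where "S F = fps_compose F (fps_const (sf_const q) * fps_X)" for F :: "'k symfun fps"
  note EK = sf_E_mult_H_neg[where 'k='k]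
  \<comment> \<open>Substituting qt for t is multiplicative, so E(t) H(-t) = 1 becomes E(qt) H(-qt)
    = 1.\<close>
  have EKq: "S sf_E * S sf_H_neg = 1"
    unfolding S_def fps_compose_linear_mult[symmetric] EK by simp
  have GE: "G * sf_E = fps_const (sf_const (inverse (q - 1))) * fps_shift 1 (S sf_E - sf_E)"
    unfolding G_def S_def q_power_sum_generating_function q_deriv_def ..
  have CC: "C * fps_const (sf_const (inverse (q - 1))) = 1"
    using q by (simp add: C_def sf_const_1 flip: sf_const_mult)
  have "C * (fps_X * (G * sf_E)) =
      (C * fps_const (sf_const (inverse (q - 1)))) * (fps_X * fps_shift 1 (S sf_E - sf_E))"
    unfolding GE by (simp only: mult_ac)
  also have "\<dots> = S sf_E - sf_E"
    unfolding CC by (subst fps_X_mult_shift_1) (auto simp: S_def)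
  finally have "C * (fps_X * (G * sf_E)) * sf_H_neg * S sf_H_neg = (S sf_E - sf_E) * sf_H_neg * S sf_H_neg"
    by simp
  \<comment> \<open>Regrouping exposes the products E(t) H(-t) and E(qt) H(-qt), both equal to
    1.\<close>
  hence "C * (fps_X * (G * S sf_H_neg)) * (sf_E * sf_H_neg) =
      (S sf_E * S sf_H_neg) * sf_H_neg - (sf_E * sf_H_neg) * S sf_H_neg"
    by (simp only: algebra_simps)
  hence "C * (fps_X * (G * S sf_H_neg)) = sf_H_neg - S sf_H_neg"
    by (simp add: EK EKq)
  moreover have "fps_nth (C * (fps_X * (G * S sf_H_neg))) (Suc n) =
      sf_const (q - 1) * fps_nth (G * S sf_H_neg) n"
    by (simp add: C_def)
  ultimately have "sf_const (q - 1) * fps_nth (G * S sf_H_neg) n =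
      fps_nth (sf_H_neg - S sf_H_neg) (Suc n)"
    by simp
  hence "sf_const (q - 1) * (\<Sum>i\<le>n. (- 1) ^ i * q_power_sum q (Suc i) *
      (sf_const q ^ (n - i) * ((- 1) ^ (n - i) * sf_h (n - i)))) =
      (- 1) ^ Suc n * sf_h (Suc n) - sf_const q ^ Suc n * ((- 1) ^ Suc n * sf_h (Suc n))"
    by (simp add: G_def S_def sf_H_neg_def fps_mult_nth atLeast0AtMost del: power_Suc)
  also have "(\<Sum>i\<le>n. (- 1) ^ i * q_power_sum q (Suc i) *
      (sf_const q ^ (n - i) * ((- 1) ^ (n - i) * sf_h (n - i)))) =
      (- 1) ^ n * (\<Sum>i\<le>n. sf_const (q ^ (n - i)) * q_power_sum q (Suc i) * sf_h (n - i))"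
    (is "_ = _ * ?R")
    unfolding sum_distrib_left
  proof (rule sum.cong)
    fix i assume "i \<in> {..n}"
    hence "(- 1 :: 'k symfun) ^ n = (- 1) ^ i * (- 1) ^ (n - i)" by (simp flip: power_add)
    thus "(- 1) ^ i * q_power_sum q (Suc i) * (sf_const q ^ (n - i) * ((- 1) ^ (n - i) * sf_h (n - i))) =
      (- 1) ^ n * (sf_const (q ^ (n - i)) * q_power_sum q (Suc i) * sf_h (n - i))"
      by (simp add: sf_const_power mult_ac)
  qed simp
  finally have "(- 1) ^ n * (sf_const (q - 1) * ?R) =
      (- 1) ^ n * (sf_const (q ^ Suc n - 1) * sf_h (Suc n))"
    by (simp add: sf_const_diff sf_const_power sf_const_mult sf_const_1 algebra_simps)
  \<comment> \<open>The sign is its own inverse, so multiplying by it again cancels it;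
    \<open>q - 1\<close> is removed below by the constant \<open>inverse (q - 1)\<close>.\<close>
  hence "(- 1) ^ n * ((- 1) ^ n * (sf_const (q - 1) * ?R)) =
      (- 1) ^ n * ((- 1) ^ n * (sf_const (q ^ Suc n - 1) * sf_h (Suc n)))"
    by (rule arg_cong)
  hence "sf_const (q - 1) * ?R = sf_const (q ^ Suc n - 1) * sf_h (Suc n)"
    by (simp add: mult.assoc[symmetric] power_mult_distrib[symmetric] del: power_Suc)
  also have "q ^ Suc n - 1 = (q - 1) * q_nat q (Suc n)"
    unfolding q_nat_def by (rule power_diff_1_eq)
  finally have "sf_const (inverse (q - 1)) * (sf_const (q - 1) * ?R) =
      sf_const (inverse (q - 1)) * (sf_const ((q - 1) * q_nat q (Suc n)) * sf_h (Suc n))"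
    by simp
  moreover have "inverse (q - 1) * ((q - 1) * q_nat q (Suc n)) = q_nat q (Suc n)"
    and "inverse (q - 1) * (q - 1) = 1"
    using q by auto
  ultimately show ?thesis
    by (simp only: mult.assoc[symmetric] sf_const_mult[symmetric]) (simp add: sf_const_1)
qed

text \<open>Division by the q-integer is possible because (q-1) [n+1] = q^(n+1) - 1 is nonzero.
  Passing to \<open>inverse q\<close> turns q^(n-i) into q^(-i), so that the part
  \<open>Suc i\<close> carries an exponent depending on that part alone.\<close>

lemma sf_h_Suc:
  fixes q :: "'k :: field"
  assumes q0: "q \<noteq> 0" and q1: "q \<noteq> 1" and nz: "q ^ Suc n \<noteq> 1"
  shows "sf_h (Suc n) = (\<Sum>i\<le>n. sf_const (inverse (q ^ i * q_nat (inverse q) (Suc n))) *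
    q_power_sum q (Suc i) * sf_h (n - i))"
proof -
  define N where "N = q_nat q (Suc n)"
  have N: "N \<noteq> 0"
    using nz power_diff_1_eq[of q "Suc n"] by (auto simp: N_def q_nat_def)
  have M: "q ^ n * q_nat (inverse q) (Suc n) = N"
    unfolding N_def by (rule q_nat_inverse[OF q0])
  have c: "inverse (q ^ i * q_nat (inverse q) (Suc n)) = inverse N * q ^ (n - i)" if "i \<le> n" for i
  proof -
    have "q ^ n = q ^ i * q ^ (n - i)" using that by (simp flip: power_add)
    hence "N = q ^ i * q_nat (inverse q) (Suc n) * q ^ (n - i)" by (simp flip: M add: mult_ac)
    thus ?thesis using N q0 by (simp add: field_simps)
  qed
  have "sf_h (Suc n) = sf_const (inverse N) * (sf_const N * sf_h (Suc n))"
    using N by (simp add: mult.assoc[symmetric] sf_const_1 flip: sf_const_mult)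
  also have "\<dots> = (\<Sum>i\<le>n. sf_const (inverse N) *
      (sf_const (q ^ (n - i)) * q_power_sum q (Suc i) * sf_h (n - i)))"
    unfolding N_def q_nat_sf_h[OF q1] sum_distrib_left ..
  also have "\<dots> = (\<Sum>i\<le>n. sf_const (inverse (q ^ i * q_nat (inverse q) (Suc n))) *
    q_power_sum q (Suc i) * sf_h (n - i))"
    by (intro sum.cong) (auto simp: c sf_const_mult mult_ac simp del: inverse_mult_distrib)
  finally show ?thesis .
qed


section \<open>Expansion over compositions\<close>

definition compositions :: "nat \<Rightarrow> nat list set"
  where "compositions n = {u. 0 \<notin> set u \<and> sum_list u = n}"

lemma compositions_0: "compositions 0 = {[]}"
proof -
  have "u = []" if "0 \<notin> set u" "\<forall>k\<in>set u. k = 0" for u :: "nat list"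
    using that by (cases u) auto
  thus ?thesis by (auto simp: compositions_def)
qed

lemma compositions_Suc:
  "compositions (Suc n) = (\<Union>i\<in>{..n}. (#) (Suc i) ` compositions (n - i))"
proof (intro equalityI subsetI)
  fix u assume u: "u \<in> compositions (Suc n)"
  then obtain k v where kv: "u = k # v" by (cases u) (auto simp: compositions_def)
  then obtain i where "k = Suc i" using u by (cases k) (auto simp: compositions_def)
  with u kv have "i \<le> n" "v \<in> compositions (n - i)" "u = Suc i # v"
    by (auto simp: compositions_def)
  thus "u \<in> (\<Union>i\<in>{..n}. (#) (Suc i) ` compositions (n - i))"
    by blast
qed (auto simp: compositions_def)

lemma finite_compositions: "finite (compositions n)"
  by (induction n rule: less_induct) (case_tac x; auto simp: compositions_0 compositions_Suc)

text \<open>Splitting off the first part \<open>Suc i\<close> gives the index range of the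
  recurrence \<open>sf_h_Suc\<close>.\<close>

lemma sum_compositions_Suc:
  "(\<Sum>u\<in>compositions (Suc n). f u) = (\<Sum>i\<le>n. \<Sum>v\<in>compositions (n - i). f (Suc i # v))"
proof -
  have "(\<Sum>u\<in>compositions (Suc n). f u) = (\<Sum>i\<le>n. \<Sum>u\<in>(#) (Suc i) ` compositions (n - i). f u)"
    unfolding compositions_Suc by (rule sum.UNION_disjoint) (auto simp: finite_compositions)
  thus ?thesis by (simp add: sum.reindex)
qed

text \<open>This keeps the natural-number exponents \<open>n - length u\<close> from being
  truncated.\<close>

lemma length_le_sum_list: "0 \<notin> set u \<Longrightarrow> length u \<le> sum_list (u :: nat list)"
  by (induction u) auto

text \<open>One summand of the reciprocal in \<open>q_z\<close>, with the total read off the list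
  itself so that induction on lists applies.\<close>

definition q_weight :: "'k :: field \<Rightarrow> nat list \<Rightarrow> 'k"
  where "q_weight q u = inverse (\<Prod>i<length u. q_nat q (sum_list u - sum_list (take i u)))"

text \<open>The factor \<open>i = 0\<close> is the q-integer of the total; the others involve only
  sums of tails of \<open>u\<close>.\<close>

lemma q_weight_Cons: "q_weight q (k # u) = inverse (q_nat q (k + sum_list u)) * q_weight q u"
  by (simp add: q_weight_def prod.lessThan_Suc_shift del: prod.lessThan_Suc)

text \<open>Each use of the recurrence strips a first part \<open>Suc i\<close> and contributes
  q^(-i); over all parts these exponents add up to \<open>n - length u\<close>.\<close>

lemma sf_h_eq_sum_compositions:
  fixes q :: "'k :: field"
  assumes q0: "q \<noteq> 0" and nz: "\<And>k. k \<ge> 1 \<Longrightarrow> q ^ k \<noteq> 1"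
  shows "sf_h n = (\<Sum>u\<in>compositions n.
    sf_const (inverse (q ^ (n - length u)) * q_weight (inverse q) u) * q_power_sum_part q (mset u))"
proof (induction n rule: less_induct)
  case (less n)
  show ?case
  proof (cases n)
    case 0
    thus ?thesis by (simp add: compositions_0 q_weight_def q_power_sum_part_def sf_const_1)
  next
    case [simp]: (Suc m)
    have "sf_h n = (\<Sum>i\<le>m. sf_const (inverse (q ^ i * q_nat (inverse q) (Suc m))) *
        q_power_sum q (Suc i) * sf_h (m - i))"
      using sf_h_Suc[of q m] nz[of 1] nz[of "Suc m"] q0 by simp
    also have "\<dots> = (\<Sum>i\<le>m. \<Sum>v\<in>compositions (m - i).
        sf_const (inverse (q ^ (n - length (Suc i # v))) * q_weight (inverse q) (Suc i # v)) *
        q_power_sum_part q (mset (Suc i # v)))"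
    proof (rule sum.cong)
      fix i assume "i \<in> {..m}"
      hence i: "i \<le> m" by simp
      have "inverse (q ^ (n - length (Suc i # v))) * q_weight (inverse q) (Suc i # v) =
          inverse (q ^ i * q_nat (inverse q) (Suc m)) *
          (inverse (q ^ (m - i - length v)) * q_weight (inverse q) v)"
        if v: "v \<in> compositions (m - i)" for v
      proof -
        \<comment> \<open>With \<open>n = Suc m\<close>, the extra list entry absorbs the successor,
          and \<open>length v \<le> m - i\<close> makes the subtractions exact.\<close>
        have "n - length (Suc i # v) = i + (m - i - length v)"
          using length_le_sum_list[of v] v i by (simp add: compositions_def)
        moreover have "q_weight (inverse q) (Suc i # v) =
            inverse (q_nat (inverse q) (Suc m)) * q_weight (inverse q) v"
          using v i by (simp add: q_weight_Cons compositions_def)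
        ultimately show ?thesis
          by (simp only: power_add inverse_mult_distrib mult_ac)
      qed
      thus "sf_const (inverse (q ^ i * q_nat (inverse q) (Suc m))) * q_power_sum q (Suc i) * sf_h (m - i) =
        (\<Sum>v\<in>compositions (m - i).
        sf_const (inverse (q ^ (n - length (Suc i # v))) * q_weight (inverse q) (Suc i # v)) *
        q_power_sum_part q (mset (Suc i # v)))"
        using i by (simp add: less.IH sum_distrib_left sf_const_mult q_power_sum_part_def mult_ac)
    qed simp
    also have "\<dots> = (\<Sum>u\<in>compositions n.
        sf_const (inverse (q ^ (n - length u)) * q_weight (inverse q) u) * q_power_sum_part q (mset u))"
      by (simp only: Suc sum_compositions_Suc)
    finally show ?thesis .
  qed
qed

section \<open>Regrouping compositions by their multiset of parts\<close>

text \<open>A composition is a rearrangement of exactly one partition, so the sets of rearrangements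
  are disjoint.\<close>

lemma sum_compositions_eq_sum_int_partitions:
  "(\<Sum>u\<in>compositions n. f u) = (\<Sum>\<mu>\<in>int_partitions n. \<Sum>u\<in>permutations_of_multiset \<mu>. f u)"
proof -
  have "compositions n = (\<Union>\<mu>\<in>int_partitions n. permutations_of_multiset \<mu>)"
    by (auto simp: compositions_def int_partitions_def permutations_of_multiset_def sum_mset_sum_list
        Suc_le_eq intro: gr0I)
  thus ?thesis
    by (simp only:) (rule sum.UNION_disjoint,
      auto simp: finite_int_partitions dest: permutations_of_multisetD)
qed

text \<open>Otherwise \<open>q\<close> would be a root of X^k - 1, an integer polynomial that is
  nonzero for \<open>k \<ge> 1\<close>.\<close>

lemma not_algebraic_imp_power_neq_1:
  fixes q :: "'k :: field_char_0"
  assumes "\<not> algebraic q" "k \<ge> 1"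
  shows "q ^ k \<noteq> 1"
proof
  assume "q ^ k = 1"
  let ?p = "monom 1 k - 1 :: 'k poly"
  have "coeff ?p k = 1" using assms(2) by (simp add: coeff_pCons split: nat.splits)
  hence "?p \<noteq> 0" by (metis coeff_0 zero_neq_one)
  moreover have "coeff ?p i \<in> \<int>" for i by (auto simp: coeff_monom)
  moreover have "poly ?p q = 0" using \<open>q ^ k = 1\<close> by (simp add: poly_monom)
  ultimately show False using assms(1) algebraicI by blast
qed

theorem theorem4p6:
  fixes q :: "'k :: field_char_0" and n :: nat
  assumes q_indeterminate: "\<not> algebraic q"
    and n: "n \<ge> 1"
  shows "sf_h n =
    (\<Sum>\<mu>\<in>int_partitions n.
       sf_const (inverse (q ^ (sum_mset \<mu> - size \<mu>) * q_z (inverse q) \<mu>)) * q_power_sum_part q \<mu>)"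
proof -
  have q0: "q \<noteq> 0" using q_indeterminate by auto
  \<comment> \<open>\<open>q_z\<close> is itself a reciprocal; \<open>inverse\<close> undoes it even
    at the default value \<open>inverse 0 = 0\<close>.\<close>
  have z: "inverse (q_z (inverse q) \<mu>) = (\<Sum>u\<in>permutations_of_multiset \<mu>. q_weight (inverse q) u)" for \<mu>
    unfolding q_z_def q_weight_def inverse_inverse_eq
    by (intro sum.cong refl) (auto simp: permutations_of_multiset_def sum_mset_sum_list)
  have "sf_h n = (\<Sum>\<mu>\<in>int_partitions n. \<Sum>u\<in>permutations_of_multiset \<mu>.
      sf_const (inverse (q ^ (n - length u)) * q_weight (inverse q) u) * q_power_sum_part q (mset u))"
    using sf_h_eq_sum_compositions[of q n] not_algebraic_imp_power_neq_1[OF q_indeterminate] q0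
    by (simp add: sum_compositions_eq_sum_int_partitions)
  also have "\<dots> = (\<Sum>\<mu>\<in>int_partitions n.
       sf_const (inverse (q ^ (sum_mset \<mu> - size \<mu>) * q_z (inverse q) \<mu>)) * q_power_sum_part q \<mu>)"
  proof (rule sum.cong)
    fix \<mu> assume "\<mu> \<in> int_partitions n"
    hence [simp]: "sum_mset \<mu> = n" by (simp add: int_partitions_def)
    \<comment> \<open>All rearrangements of \<open>\<mu>\<close> share the power of \<open>q\<close>
      and the product of q-power sums; only \<open>q_weight\<close> depends on the order.\<close>
    have "(\<Sum>u\<in>permutations_of_multiset \<mu>.
        sf_const (inverse (q ^ (n - length u)) * q_weight (inverse q) u) * q_power_sum_part q (mset u)) =
        (\<Sum>u\<in>permutations_of_multiset \<mu>.
        sf_const (inverse (q ^ (n - size \<mu>)) * q_weight (inverse q) u) * q_power_sum_part q \<mu>)"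
      by (intro sum.cong) (auto simp: permutations_of_multiset_def)
    also have "\<dots> = sf_const (inverse (q ^ (n - size \<mu>) * q_z (inverse q) \<mu>)) * q_power_sum_part q \<mu>"
      by (simp add: z sf_const_mult sf_const_sum sum_distrib_left sum_distrib_right)
    finally show "(\<Sum>u\<in>permutations_of_multiset \<mu>.
        sf_const (inverse (q ^ (n - length u)) * q_weight (inverse q) u) * q_power_sum_part q (mset u)) =
        sf_const (inverse (q ^ (sum_mset \<mu> - size \<mu>) * q_z (inverse q) \<mu>)) * q_power_sum_part q \<mu>"
      by simp
  qed simp
  finally show ?thesis .
qed

end
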